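(* Let $L_i$, $V_i$, $i=1,2$, be finite-dimensional vector spaces over a field $F$ and let $\varphi_i\colon L_i\times L_i\to V_i$ be bilinear skew-symmetric maps. Denote $L=L_1\oplus L_2$ and $V=V_1\oplus V_2\oplus V_3$, where $V_3=L_1\otimes L_2$, and let $\varphi\colon L\times L\to V$ be the bilinear skew-symmetric map such that $\varphi|_{L_i\times L_i}=\varphi_i$, $i=1,2$, and $\varphi|_{L_1\times L_2}=\otimes$; i.e., $$\varphi(x,y)=\varphi_1(x_1,y_1)+\varphi_2(x_2,y_2)+(x_1\otimes y_2-y_1\otimes x_2),$$ where $x_i,y_i\in L_i$ are the projections of $x,y\in L$ and the three summands lie in $V_1$, $V_2$, $V_3$, respectively. Then: (1) A subspace $H\subseteq L$ is isotropic if and only if $\dim H=1$ or $H=H_i$, where $H_i\subseteq L_i$ is isotropic under $\varphi_i$, for $i=1$ or $2$. (2) $\mathcal{H}(\varphi)=\{1\}\cup\mathcal{H}(\varphi_1)\cup\mathcal{H}(\varphi_2)$, except that, for $\{i,j\}=\{1,2\}$, $\mathcal{H}(\varphi)=\mathcal{H}(\varphi_i)$ if $h(\varphi_j)=0$, i.e., if either $L_j=0$, or $L_j=F$, $\operatorname{char}F=2$, and $\varphi_j\not\equiv 0$. (3) $h(\varphi)=\max\{h(\varphi_1),h(\varphi_2)\}$.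
   Context: For a bilinear map $\psi\colon U\times U\to W$ of finite-dimensional vector spaces, a subspace $H\subseteq U$ is isotropic under $\psi$ if $\psi(u_1,u_2)=0$ for all $u_1,u_2\in H$; it is maximal isotropic if it is isotropic and not properly contained in another isotropic subspace. $\mathcal{H}(\psi)$ is the set of dimensions of all maximal isotropic subspaces of $U$, and $h(\psi)=\max\mathcal{H}(\psi)$ (the isotropy index). Skew-symmetric means $\psi(x,y)=-\psi(y,x)$ for all $x,y$ (so in characteristic $2$, $\psi(x,x)$ need not vanish).
   Formalization: In characteristic 2 two claims are corrected: in (1) a subspace H with dim H=1 must also satisfy φ_1(x_1,x_1)=φ_2(x_2,x_2)=0 for all x in H, and in (2) the cases of h(φ_j)=0 also include dim L_j≥2, char F=2 and φ_j(x,x)≠0 for all x≠0. *)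

theory Defs
  imports "HOL-Analysis.Analysis" "HOL-Library.Poly_Mapping"
begin

text \<open>
  A vector space over a field \<open>'f\<close> is a type together with a scalar multiplication satisfying the
  locale \<^locale>\<open>vector_space\<close>.
\<close>

section \<open>Bilinear maps\<close>

definition bilinear_map ::
  "('f::field \<Rightarrow> 'a::ab_group_add \<Rightarrow> 'a) \<Rightarrow> ('f \<Rightarrow> 'b::ab_group_add \<Rightarrow> 'b) \<Rightarrow>
   ('f \<Rightarrow> 'c::ab_group_add \<Rightarrow> 'c) \<Rightarrow> ('a \<Rightarrow> 'b \<Rightarrow> 'c) \<Rightarrow> bool"
  where "bilinear_map sa sb sc f \<longleftrightarrow>
    (\<forall>x. Vector_Spaces.linear sb sc (f x)) \<and> (\<forall>y. Vector_Spaces.linear sa sc (\<lambda>x. f x y))"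

definition skew_symmetric :: "('a \<Rightarrow> 'a \<Rightarrow> 'c::ab_group_add) \<Rightarrow> bool"
  where "skew_symmetric f \<longleftrightarrow> (\<forall>x y. f x y = - f y x)"

section \<open>Isotropic subspaces\<close>

definition isotropic ::
  "('f::field \<Rightarrow> 'a::ab_group_add \<Rightarrow> 'a) \<Rightarrow> ('a \<Rightarrow> 'a \<Rightarrow> 'c::zero) \<Rightarrow> 'a set \<Rightarrow> bool"
  where "isotropic s \<psi> H \<longleftrightarrow> module.subspace s H \<and> (\<forall>u\<in>H. \<forall>v\<in>H. \<psi> u v = 0)"

definition maximal_isotropic ::
  "('f::field \<Rightarrow> 'a::ab_group_add \<Rightarrow> 'a) \<Rightarrow> ('a \<Rightarrow> 'a \<Rightarrow> 'c::zero) \<Rightarrow> 'a set \<Rightarrow> bool"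
  where "maximal_isotropic s \<psi> H \<longleftrightarrow> isotropic s \<psi> H \<and> (\<nexists>K. isotropic s \<psi> K \<and> H \<subset> K)"

definition isotropic_dims ::
  "('f::field \<Rightarrow> 'a::ab_group_add \<Rightarrow> 'a) \<Rightarrow> ('a \<Rightarrow> 'a \<Rightarrow> 'c::zero) \<Rightarrow> nat set"
  where "isotropic_dims s \<psi> = vector_space.dim s ` {H. maximal_isotropic s \<psi> H}"

definition isotropy_index ::
  "('f::field \<Rightarrow> 'a::ab_group_add \<Rightarrow> 'a) \<Rightarrow> ('a \<Rightarrow> 'a \<Rightarrow> 'c::zero) \<Rightarrow> nat"
  where "isotropy_index s \<psi> = Max (isotropic_dims s \<psi>)"

section \<open>Tensor products\<close>

text \<open>
  The tensor product is the free vector space on \<open>A \<times> B\<close>, here \<open>('a \<times> 'b) \<Rightarrow>\<^sub>0 'f\<close>, modulo the subspace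
  spanned by the usual relations. The relations depend on the scalar multiplications, which are
  terms, so that the quotient cannot be formed as a type; instead \<open>is_tensor_product sa sb st t\<close> says
  that \<open>(a, b) \<mapsto> t a b\<close> induces an isomorphism from this quotient onto the vector space \<open>st\<close>.
  Lemma \<open>tensor_product_universal\<close> below gives the universal property.
\<close>

definition free_scale :: "'f::field \<Rightarrow> ('i \<Rightarrow>\<^sub>0 'f) \<Rightarrow> ('i \<Rightarrow>\<^sub>0 'f)"
  where "free_scale c p = Poly_Mapping.map ((*) c) p"

definition free_lift ::
  "('f::field \<Rightarrow> 'c::ab_group_add \<Rightarrow> 'c) \<Rightarrow> ('a \<Rightarrow> 'b \<Rightarrow> 'c) \<Rightarrow> ('a \<times> 'b \<Rightarrow>\<^sub>0 'f) \<Rightarrow> 'c"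
  where "free_lift sc f p = (\<Sum>(a, b)\<in>Poly_Mapping.keys p. sc (Poly_Mapping.lookup p (a, b)) (f a b))"

definition tensor_relations ::
  "('f::field \<Rightarrow> 'a::ab_group_add \<Rightarrow> 'a) \<Rightarrow> ('f \<Rightarrow> 'b::ab_group_add \<Rightarrow> 'b) \<Rightarrow> ('a \<times> 'b \<Rightarrow>\<^sub>0 'f) set"
  where "tensor_relations sa sb =
    {Poly_Mapping.single (a + a', b) 1 - Poly_Mapping.single (a, b) 1
       - Poly_Mapping.single (a', b) 1 | a a' b. True} \<union>
    {Poly_Mapping.single (a, b + b') 1 - Poly_Mapping.single (a, b) 1
       - Poly_Mapping.single (a, b') 1 | a b b'. True} \<union>
    {Poly_Mapping.single (sa c a, b) 1 - Poly_Mapping.single (a, b) c | c a b. True} \<union>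
    {Poly_Mapping.single (a, sb c b) 1 - Poly_Mapping.single (a, b) c | c a b. True}"

definition is_tensor_product ::
  "('f::field \<Rightarrow> 'a::ab_group_add \<Rightarrow> 'a) \<Rightarrow> ('f \<Rightarrow> 'b::ab_group_add \<Rightarrow> 'b) \<Rightarrow>
   ('f \<Rightarrow> 't::ab_group_add \<Rightarrow> 't) \<Rightarrow> ('a \<Rightarrow> 'b \<Rightarrow> 't) \<Rightarrow> bool"
  where "is_tensor_product sa sb st t \<longleftrightarrow>
    vector_space sa \<and> vector_space sb \<and> vector_space st \<and>
    surj (free_lift st t) \<and>
    {p. free_lift st t p = 0} = module.span free_scale (tensor_relations sa sb)"

lemma lookup_free_scale [simp]:
  "Poly_Mapping.lookup (free_scale c p) i = c * Poly_Mapping.lookup p i"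
  by (simp add: free_scale_def Poly_Mapping.map.rep_eq when_def)

lemma vector_space_free_scale: "vector_space (free_scale :: 'f::field \<Rightarrow> ('i \<Rightarrow>\<^sub>0 'f) \<Rightarrow> _)"
  by unfold_locales
    (auto intro!: poly_mapping_eqI simp: Poly_Mapping.lookup_add algebra_simps)

lemma free_lift_superset:
  assumes "vector_space sc" and "finite S" and "Poly_Mapping.keys p \<subseteq> S"
  shows "free_lift sc f p = (\<Sum>(a, b)\<in>S. sc (Poly_Mapping.lookup p (a, b)) (f a b))"
proof -
  interpret vector_space sc by fact
  show ?thesis
    unfolding free_lift_def using assms
    by (intro sum.mono_neutral_left) (auto simp: in_keys_iff)
qed

lemma linear_free_lift:
  fixes sc :: "'f::field \<Rightarrow> 'c::ab_group_add \<Rightarrow> 'c" and f :: "'a \<Rightarrow> 'b \<Rightarrow> 'c"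
  assumes "vector_space sc"
  shows "Vector_Spaces.linear free_scale sc (free_lift sc f)"
proof -
  interpret c: vector_space sc by fact
  interpret fr: vector_space "free_scale :: 'f \<Rightarrow> ('a \<times> 'b \<Rightarrow>\<^sub>0 'f) \<Rightarrow> _"
    by (rule vector_space_free_scale)
  show ?thesis
  proof unfold_locales
    fix p q :: "'a \<times> 'b \<Rightarrow>\<^sub>0 'f"
    let ?S = "Poly_Mapping.keys p \<union> Poly_Mapping.keys q"
    have "Poly_Mapping.keys (p + q) \<subseteq> ?S" by (rule Poly_Mapping.keys_add)
    then have "free_lift sc f (p + q) = (\<Sum>(a, b)\<in>?S. sc (Poly_Mapping.lookup (p + q) (a, b)) (f a b))"
      by (intro free_lift_superset assms) auto
    also have "\<dots> = (\<Sum>(a, b)\<in>?S. sc (Poly_Mapping.lookup p (a, b)) (f a b))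
        + (\<Sum>(a, b)\<in>?S. sc (Poly_Mapping.lookup q (a, b)) (f a b))"
      by (simp add: Poly_Mapping.lookup_add c.scale_left_distrib sum.distrib split_beta)
    also have "\<dots> = free_lift sc f p + free_lift sc f q"
      by (subst (1 2) free_lift_superset[OF assms, where S = ?S]) auto
    finally show "free_lift sc f (p + q) = free_lift sc f p + free_lift sc f q" .
  next
    fix k and p :: "'a \<times> 'b \<Rightarrow>\<^sub>0 'f"
    have "Poly_Mapping.keys (free_scale k p) \<subseteq> Poly_Mapping.keys p"
      by (auto simp: in_keys_iff)
    then have "free_lift sc f (free_scale k p) =
        (\<Sum>(a, b)\<in>Poly_Mapping.keys p. sc (Poly_Mapping.lookup (free_scale k p) (a, b)) (f a b))"
      by (intro free_lift_superset assms) auto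
    then show "free_lift sc f (free_scale k p) = sc k (free_lift sc f p)"
      unfolding free_lift_def by (simp add: c.scale_sum_right split_beta)
  qed
qed

lemma free_lift_single:
  assumes "vector_space sc"
  shows "free_lift sc f (Poly_Mapping.single (a, b) c) = sc c (f a b)"
proof -
  interpret vector_space sc by fact
  have "free_lift sc f (Poly_Mapping.single (a, b) c) = (\<Sum>(a', b')\<in>{(a, b)}.
      sc (Poly_Mapping.lookup (Poly_Mapping.single (a, b) c) (a', b')) (f a' b'))"
    by (rule free_lift_superset) (auto simp: assms)
  then show ?thesis by simp
qed

lemma free_lift_bilinear_relations:
  assumes "bilinear_map sa sb sc f" and "p \<in> module.span free_scale (tensor_relations sa sb)"
  shows "free_lift sc f p = 0"
proof -
  have lr: "Vector_Spaces.linear sb sc (f x)" "Vector_Spaces.linear sa sc (\<lambda>x. f x y)" for x y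
    using assms(1) by (auto simp: bilinear_map_def)
  have vs: "vector_space sc" using lr(1) by (simp add: Vector_Spaces.linear_def)
  interpret c: vector_space sc by fact
  interpret fl: Vector_Spaces.linear free_scale sc "free_lift sc f"
    by (rule linear_free_lift[OF vs])
  interpret l: Vector_Spaces.linear sa sc "\<lambda>x. f x y" for y by (rule lr)
  interpret r: Vector_Spaces.linear sb sc "f x" for x by (rule lr)
  have "free_lift sc f q = 0" if "q \<in> tensor_relations sa sb" for q
    using that unfolding tensor_relations_def
    by (auto simp: fl.diff free_lift_single[OF vs] l.add r.add l.scale r.scale)
  then show ?thesis
    using assms(2) fl.eq_0_on_span by blast
qed

lemma is_tensor_product_bilinear:
  fixes sa :: "'f::field \<Rightarrow> 'a::ab_group_add \<Rightarrow> 'a" and sb :: "'f \<Rightarrow> 'b::ab_group_add \<Rightarrow> 'b"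
  assumes "is_tensor_product sa sb st t"
  shows "bilinear_map sa sb st t"
proof -
  have vs: "vector_space sa" "vector_space sb" "vector_space st"
    and ker: "{p. free_lift st t p = 0} = module.span free_scale (tensor_relations sa sb)"
    using assms by (auto simp: is_tensor_product_def)
  interpret a: vector_space sa by fact
  interpret b: vector_space sb by fact
  interpret c: vector_space st by fact
  interpret fr: vector_space "free_scale :: 'f \<Rightarrow> ('a \<times> 'b \<Rightarrow>\<^sub>0 'f) \<Rightarrow> _"
    by (rule vector_space_free_scale)
  interpret fl: Vector_Spaces.linear free_scale st "free_lift st t"
    by (rule linear_free_lift) fact
  have rel: "free_lift st t p = 0" if "p \<in> tensor_relations sa sb" for p
    using ker fr.span_base[OF that] by blast
  note fls = fl.diff free_lift_single[OF vs(3)]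
  have add1: "t (x + x') y = t x y + t x' y" for x x' y
  proof -
    have "free_lift st t (Poly_Mapping.single (x + x', y) 1 - Poly_Mapping.single (x, y) 1
       - Poly_Mapping.single (x', y) 1) = 0"
      by (rule rel) (unfold tensor_relations_def, blast)
    then show ?thesis by (simp add: fls fl.add algebra_simps)
  qed
  have add2: "t x (y + y') = t x y + t x y'" for x y y'
  proof -
    have "free_lift st t (Poly_Mapping.single (x, y + y') 1 - Poly_Mapping.single (x, y) 1
       - Poly_Mapping.single (x, y') 1) = 0"
      by (rule rel) (unfold tensor_relations_def, blast)
    then show ?thesis by (simp add: fls fl.add algebra_simps)
  qed
  have scale1: "t (sa k x) y = st k (t x y)" for k x y
  proof -
    have "free_lift st t (Poly_Mapping.single (sa k x, y) 1 - Poly_Mapping.single (x, y) k) = 0"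
      by (rule rel) (unfold tensor_relations_def, blast)
    then show ?thesis by (simp add: fls)
  qed
  have scale2: "t x (sb k y) = st k (t x y)" for k x y
  proof -
    have "free_lift st t (Poly_Mapping.single (x, sb k y) 1 - Poly_Mapping.single (x, y) k) = 0"
      by (rule rel) (unfold tensor_relations_def, blast)
    then show ?thesis by (simp add: fls)
  qed
  show ?thesis
    unfolding bilinear_map_def
    by (intro conjI allI; unfold_locales) (rule add1 add2 scale1 scale2)+
qed

lemma tensor_product_universal:
  assumes "is_tensor_product sa sb st t" and "bilinear_map sa sb sc f"
  shows "\<exists>!g. Vector_Spaces.linear st sc g \<and> (\<forall>a b. g (t a b) = f a b)"
proof -
  have vs: "vector_space st" and sur: "surj (free_lift st t)"
    and ker: "{p. free_lift st t p = 0} = module.span free_scale (tensor_relations sa sb)"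
    using assms(1) by (auto simp: is_tensor_product_def)
  have vsc: "vector_space sc"
    using assms(2) by (auto simp: bilinear_map_def Vector_Spaces.linear_def)
  interpret st: vector_space st by fact
  interpret sc: vector_space sc by fact
  interpret T: Vector_Spaces.linear free_scale st "free_lift st t" by (rule linear_free_lift) fact
  interpret F: Vector_Spaces.linear free_scale sc "free_lift sc f" by (rule linear_free_lift) fact
  have fac: "free_lift sc f p = free_lift sc f q" if "free_lift st t p = free_lift st t q" for p q
  proof -
    have "free_lift st t (p - q) = 0" using that by (simp add: T.diff)
    then have "p - q \<in> module.span free_scale (tensor_relations sa sb)" using ker by blast
    then have "free_lift sc f (p - q) = 0" by (rule free_lift_bilinear_relations[OF assms(2)])
    then show ?thesis by (simp add: F.diff)
  qed
  define g where "g v = free_lift sc f (inv (free_lift st t) v)" for v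
  have g: "g (free_lift st t p) = free_lift sc f p" for p
    unfolding g_def by (rule fac) (simp add: sur surj_f_inv_f)
  have lin: "Vector_Spaces.linear st sc g"
  proof unfold_locales
    fix v w
    obtain p q where "v = free_lift st t p" "w = free_lift st t q" using sur by (meson surjD)
    then show "g (v + w) = g v + g w" by (metis F.add T.add g)
  next
    fix k v
    obtain p where "v = free_lift st t p" using sur by (meson surjD)
    then show "g (st k v) = sc k (g v)" by (metis F.scale T.scale g)
  qed
  have gt: "g (t a b) = f a b" for a b
    using g[of "Poly_Mapping.single (a, b) 1"] by (simp add: free_lift_single vs vsc)
  have "h = g" if h: "Vector_Spaces.linear st sc h" "\<forall>a b. h (t a b) = f a b" for h
  proof
    fix v
    interpret h: Vector_Spaces.linear st sc h by fact
    obtain p where p: "v = free_lift st t p" using sur by (meson surjD)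
    have "h v = free_lift sc f p"
      unfolding p free_lift_def by (simp add: h.sum h.scale split_beta h(2))
    then show "h v = g v" using g p by simp
  qed
  with lin gt show ?thesis by blast
qed

section \<open>The map on the direct sum\<close>

text \<open>
  On the diagonal the tensor component vanishes, so a line spanned by \<open>x\<close> is isotropic if and only if
  \<open>\<phi>\<^sub>1 (fst x) (fst x) = 0\<close> and \<open>\<phi>\<^sub>2 (snd x) (snd x) = 0\<close>. Skew-symmetry implies this except in
  characteristic 2. There, moreover, a skew-symmetric map can have isotropy index 0 in any dimension:
  componentwise multiplication on \<open>F\<^sup>2\<close> is skew-symmetric and has no nonzero isotropic vector.
\<close>

definition direct_sum_map ::
  "('a \<Rightarrow> 'a \<Rightarrow> 'v) \<Rightarrow> ('b \<Rightarrow> 'b \<Rightarrow> 'w) \<Rightarrow> ('a \<Rightarrow> 'b \<Rightarrow> 't::ab_group_add) \<Rightarrow>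
   'a \<times> 'b \<Rightarrow> 'a \<times> 'b \<Rightarrow> 'v \<times> 'w \<times> 't"
  where "direct_sum_map \<phi>\<^sub>1 \<phi>\<^sub>2 t x y =
    (\<phi>\<^sub>1 (fst x) (fst y), \<phi>\<^sub>2 (snd x) (snd y), t (fst x) (snd y) - t (fst y) (snd x))"

lemma skew_symmetric_direct_sum_map:
  assumes "skew_symmetric \<phi>\<^sub>1" and "skew_symmetric \<phi>\<^sub>2"
  shows "skew_symmetric (direct_sum_map \<phi>\<^sub>1 \<phi>\<^sub>2 t)"
proof -
  have "\<phi>\<^sub>1 a a' = - \<phi>\<^sub>1 a' a" and "\<phi>\<^sub>2 b b' = - \<phi>\<^sub>2 b' b" for a a' b b'
    using assms unfolding skew_symmetric_def by blast+
  then show ?thesis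
    unfolding skew_symmetric_def direct_sum_map_def uminus_prod_def fst_conv snd_conv minus_diff_eq
    by blast
qed

lemma vector_space_prod_scale:
  assumes "vector_space s" and "vector_space s'"
  shows "vector_space (module_prod.scale s s')"
proof -
  interpret vector_space_prod s s'
    using assms by (simp add: vector_space_prod_def vector_space_pair_def)
  show ?thesis by (rule p.vector_space_axioms)
qed

lemma prod_scale_eq:
  assumes "vector_space s" and "vector_space s'"
  shows "module_prod.scale s s' c x = (s c (fst x), s' c (snd x))"
proof -
  interpret vector_space_prod s s'
    using assms by (simp add: vector_space_prod_def vector_space_pair_def)
  show ?thesis by (rule scale_def)
qed

lemma bilinear_direct_sum_map:
  assumes "bilinear_map s\<^sub>1 s\<^sub>1 r\<^sub>1 \<phi>\<^sub>1" and "bilinear_map s\<^sub>2 s\<^sub>2 r\<^sub>2 \<phi>\<^sub>2" and "bilinear_map s\<^sub>1 s\<^sub>2 r\<^sub>3 t"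
  shows "bilinear_map (module_prod.scale s\<^sub>1 s\<^sub>2) (module_prod.scale s\<^sub>1 s\<^sub>2)
    (module_prod.scale r\<^sub>1 (module_prod.scale r\<^sub>2 r\<^sub>3)) (direct_sum_map \<phi>\<^sub>1 \<phi>\<^sub>2 t)"
proof -
  have lin: "Vector_Spaces.linear s\<^sub>1 r\<^sub>1 (\<phi>\<^sub>1 a)" "Vector_Spaces.linear s\<^sub>1 r\<^sub>1 (\<lambda>x. \<phi>\<^sub>1 x a)"
    "Vector_Spaces.linear s\<^sub>2 r\<^sub>2 (\<phi>\<^sub>2 b)" "Vector_Spaces.linear s\<^sub>2 r\<^sub>2 (\<lambda>x. \<phi>\<^sub>2 x b)"
    "Vector_Spaces.linear s\<^sub>2 r\<^sub>3 (t a)" "Vector_Spaces.linear s\<^sub>1 r\<^sub>3 (\<lambda>x. t x b)" for a b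
    using assms by (auto simp: bilinear_map_def)
  have vs: "vector_space s\<^sub>1" "vector_space r\<^sub>1" "vector_space s\<^sub>2" "vector_space r\<^sub>2" "vector_space r\<^sub>3"
    using lin by (auto simp: Vector_Spaces.linear_def)
  interpret r3: vector_space r\<^sub>3 by fact
  note vp = vector_space_prod_scale[OF vs(1,3)]
    vector_space_prod_scale[OF vs(2) vector_space_prod_scale[OF vs(4,5)]]
  note pe = prod_scale_eq[OF vs(1,3)] prod_scale_eq[OF vs(4,5)]
    prod_scale_eq[OF vs(2) vector_space_prod_scale[OF vs(4,5)]]
  interpret P: vector_space "module_prod.scale s\<^sub>1 s\<^sub>2" by (rule vp)
  interpret Q: vector_space "module_prod.scale r\<^sub>1 (module_prod.scale r\<^sub>2 r\<^sub>3)" by (rule vp)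
  note hom = lin[THEN Vector_Spaces.linear.axioms(3), THEN module_hom.add]
    lin[THEN Vector_Spaces.linear.axioms(3), THEN module_hom.scale]
  show ?thesis
    unfolding bilinear_map_def
    by (intro conjI allI; unfold_locales)
      (simp_all add: direct_sum_map_def pe hom r3.scale_right_diff_distrib)
qed

end

theory Submission
  imports Defs
begin

text \<open>
  Two vectors \<open>(a, b)\<close> and \<open>(c, d)\<close> of the direct sum are orthogonal only if \<open>a \<otimes> d = c \<otimes> b\<close> in the
  tensor product, and equalities between pure tensors are very restrictive: by
  \<open>pure_tensor_eq_imp_left_zero\<close>, \<open>a \<noteq> 0\<close> forces \<open>d\<close> to be a multiple of \<open>b\<close>. Hence an isotropic
  subspace containing a mixed vector \<open>(a, b)\<close>, with \<open>a\<close> and \<open>b\<close> both nonzero, consists of the multiples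
  of that vector (\<open>isotropic_mixed_vector_is_line\<close>), and one containing a nonzero vector of one summand
  lies in that summand (\<open>isotropic_confined_left\<close>, \<open>isotropic_confined_right\<close>). So every isotropic
  subspace is a mixed line or an isotropic subspace of a summand, and a line \<open>span {x}\<close> is isotropic
  if and only if both diagonal values at the components of \<open>x\<close> vanish, which is automatic outside
  characteristic \<open>2\<close>.

  The dimensions of the maximal isotropic subspaces follow. If both summands contain nonzero isotropic
  vectors \<open>u\<close> and \<open>v\<close>, then \<open>span {(u, v)}\<close> is a maximal isotropic line, and a maximal isotropic subspace
  of a summand, being nonzero, is confined to that summand and stays maximal in the direct sum. If one
  summand has no nonzero isotropic vector, every isotropic subspace lies in the other summand. The
  isotropy index of a bilinear map is \<open>0\<close> exactly when it has no nonzero isotropic vector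
  (\<open>isotropy_index_eq_0_iff\<close>), so these two cases are the ones distinguished by the indices.
\<close>

section \<open>Bilinear and skew-symmetric maps\<close>

lemma bilinear_map_zero:
  assumes "bilinear_map sa sb sc f"
  shows "f 0 y = 0" and "f x 0 = 0"
proof -
  interpret l: Vector_Spaces.linear sa sc "\<lambda>x. f x y" using assms by (auto simp: bilinear_map_def)
  interpret r: Vector_Spaces.linear sb sc "f x" using assms by (auto simp: bilinear_map_def)
  show "f 0 y = 0" by (rule l.zero)
  show "f x 0 = 0" by (rule r.zero)
qed

lemma bilinear_map_scale:
  assumes "bilinear_map sa sb sc f"
  shows "f (sa c x) y = sc c (f x y)" and "f x (sb c y) = sc c (f x y)"
proof -
  interpret l: Vector_Spaces.linear sa sc "\<lambda>x. f x y" using assms by (auto simp: bilinear_map_def)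
  interpret r: Vector_Spaces.linear sb sc "f x" using assms by (auto simp: bilinear_map_def)
  show "f (sa c x) y = sc c (f x y)" by (rule l.scale)
  show "f x (sb c y) = sc c (f x y)" by (rule r.scale)
qed

lemma bilinear_map_diff_left:
  assumes "bilinear_map sa sb sc f"
  shows "f (x - x') y = f x y - f x' y"
proof -
  interpret l: Vector_Spaces.linear sa sc "\<lambda>x. f x y" using assms by (auto simp: bilinear_map_def)
  show ?thesis by (rule l.diff)
qed

text \<open>Skew-symmetry gives \<open>2 \<cdot> f x x = 0\<close>, and \<open>2\<close> is invertible.\<close>

lemma skew_symmetric_diagonal_eq_0:
  fixes sc :: "'f::field \<Rightarrow> 'c::ab_group_add \<Rightarrow> 'c" and f :: "'a \<Rightarrow> 'a \<Rightarrow> 'c"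
  assumes "vector_space sc" and "skew_symmetric f" and "CHAR('f) \<noteq> 2"
  shows "f x x = 0"
proof -
  interpret vector_space sc by fact
  have "(of_nat 2 :: 'f) \<noteq> 0"
    unfolding of_nat_eq_0_iff_char_dvd using assms(3)
    by (metis CHAR_not_1 One_nat_def prime_nat_iff two_is_prime_nat)
  then have two: "(1 + 1 :: 'f) \<noteq> 0" by simp
  have "f x x = - f x x" using assms(2) unfolding skew_symmetric_def by blast
  then have "f x x + f x x = 0" by (metis add.left_inverse)
  then have "sc (1 + 1) (f x x) = 0" by (simp only: scale_left_distrib scale_one)
  with two show ?thesis by (simp only: scale_eq_0_iff) simp
qed

section \<open>Isotropic subspaces and the isotropy index\<close>

context vector_space
begin

lemma isotropic_span_singleton_iff:
  assumes "bilinear_map scale scale r f"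
  shows "isotropic scale f (span {x}) \<longleftrightarrow> f x x = 0"
proof
  assume "isotropic scale f (span {x})"
  then show "f x x = 0" by (auto simp: isotropic_def span_base)
next
  have "vector_space r"
    using assms by (auto simp: bilinear_map_def Vector_Spaces.linear_def)
  then interpret r: vector_space r .
  assume "f x x = 0"
  then show "isotropic scale f (span {x})"
    unfolding isotropic_def using subspace_span[of "{x}"]
    by (auto simp: span_singleton bilinear_map_scale[OF assms])
qed

lemma isotropic_zero:
  assumes "bilinear_map scale scale r f"
  shows "isotropic scale f {0}"
  using bilinear_map_zero[OF assms] by (auto simp: isotropic_def)

end

lemma isotropic_dimsI:
  "maximal_isotropic s f H \<Longrightarrow> vector_space.dim s H \<in> isotropic_dims s f"
  by (simp add: isotropic_dims_def)

context finite_dimensional_vector_space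
begin

text \<open>
  Among the isotropic subspaces containing \<open>H\<close>, one of largest dimension is maximal.
\<close>

lemma isotropic_extends_to_maximal:
  assumes "isotropic scale f H"
  obtains K where "maximal_isotropic scale f K" and "H \<subseteq> K"
proof -
  let ?P = "\<lambda>K. isotropic scale f K \<and> H \<subseteq> K"
  have "?P H" using assms by simp
  moreover have "\<forall>K. ?P K \<longrightarrow> dim K < Suc dimension"
    using dim_subset_UNIV by (simp add: less_Suc_eq_le)
  ultimately have "\<exists>K. ?P K \<and> (\<forall>K'. ?P K' \<longrightarrow> dim K' \<le> dim K)"
    by (rule ex_has_greatest_nat)
  then obtain K where K: "?P K" and greatest: "\<And>K'. ?P K' \<Longrightarrow> dim K' \<le> dim K"
    by auto
  have "\<not> K \<subset> K'" if "isotropic scale f K'" for K'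
  proof
    assume "K \<subset> K'"
    then have "dim K' \<le> dim K" using that K greatest by blast
    then have "K = K'"
      using subspace_dim_equal K that \<open>K \<subset> K'\<close> unfolding isotropic_def by blast
    then show False using \<open>K \<subset> K'\<close> by blast
  qed
  then have "maximal_isotropic scale f K" using K by (auto simp: maximal_isotropic_def)
  then show thesis using that K by blast
qed

lemma finite_isotropic_dims: "finite (isotropic_dims scale f)"
  by (rule finite_subset[of _ "{..dimension}"])
    (auto simp: isotropic_dims_def dim_subset_UNIV)

lemma isotropic_dims_nonempty:
  assumes "bilinear_map scale scale r f"
  shows "isotropic_dims scale f \<noteq> {}"
  using isotropic_extends_to_maximal[OF isotropic_zero[OF assms]]
  by (force simp: isotropic_dims_def)

text \<open>
  A nonzero vector \<open>x\<close> with \<open>f x x = 0\<close> spans an isotropic line, and every nonzero isotropic subspace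
  contains such a vector.
\<close>

lemma isotropy_index_eq_0_iff:
  assumes "bilinear_map scale scale r f"
  shows "isotropy_index scale f = 0 \<longleftrightarrow> (\<forall>x. f x x = 0 \<longrightarrow> x = 0)"
proof -
  have "isotropy_index scale f = 0 \<longleftrightarrow> (\<forall>H. maximal_isotropic scale f H \<longrightarrow> dim H = 0)"
  proof -
    have "isotropy_index scale f = 0 \<longleftrightarrow> (\<forall>n\<in>isotropic_dims scale f. n \<le> 0)"
      unfolding isotropy_index_def
      using Max_le_iff[OF finite_isotropic_dims isotropic_dims_nonempty[OF assms], of 0] by simp
    then show ?thesis by (auto simp: isotropic_dims_def)
  qed
  also have "\<dots> \<longleftrightarrow> (\<forall>x. f x x = 0 \<longrightarrow> x = 0)"
  proof (intro iffI allI impI)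
    fix x assume max0: "\<forall>H. maximal_isotropic scale f H \<longrightarrow> dim H = 0" and "f x x = 0"
    then have "isotropic scale f (span {x})"
      by (simp add: isotropic_span_singleton_iff[OF assms])
    then obtain K where "maximal_isotropic scale f K" "span {x} \<subseteq> K"
      by (rule isotropic_extends_to_maximal)
    then have "span {x} \<subseteq> {0}" using max0 by simp blast
    then show "x = 0" using span_base[of x "{x}"] by blast
  next
    fix H assume "\<forall>x. f x x = 0 \<longrightarrow> x = 0" and "maximal_isotropic scale f H"
    then show "dim H = 0" by (auto simp: maximal_isotropic_def isotropic_def)
  qed
  finally show ?thesis .
qed

lemma maximal_isotropic_nonzero:
  assumes "bilinear_map scale scale r f" and "isotropy_index scale f \<noteq> 0"
    and "maximal_isotropic scale f H"
  obtains a where "a \<in> H" and "a \<noteq> 0"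
proof -
  obtain x where x: "f x x = 0" "x \<noteq> 0"
    using assms(2) by (auto simp: isotropy_index_eq_0_iff[OF assms(1)])
  have iso: "isotropic scale f (span {x})"
    using x by (simp add: isotropic_span_singleton_iff[OF assms(1)])
  have xs: "x \<in> span {x}" by (simp add: span_base)
  have "H \<noteq> {0}"
  proof
    assume "H = {0}"
    then have "H \<subset> span {x}" using xs x(2) span_zero[of "{x}"] by blast
    then show False using iso assms(3) by (auto simp: maximal_isotropic_def)
  qed
  moreover have "0 \<in> H"
    using assms(3) subspace_0 by (auto simp: maximal_isotropic_def isotropic_def)
  ultimately show thesis using that by blast
qed

text \<open>
  Outside characteristic \<open>2\<close> a skew-symmetric map vanishes on the diagonal, so index \<open>0\<close> is then only
  possible on the zero space. If \<open>e\<close> spans the whole space, all values of the map are multiples of \<open>f e e\<close>,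
  so the map is nonzero if and only if it has no nonzero isotropic vector.
\<close>

lemma isotropy_index_eq_0_cases:
  fixes r :: "'a \<Rightarrow> 'c::ab_group_add \<Rightarrow> 'c"
  assumes bil: "bilinear_map scale scale r f" and "skew_symmetric f"
  shows "isotropy_index scale f = 0 \<longleftrightarrow>
    (UNIV :: 'b set) = {0} \<or>
    dim UNIV = 1 \<and> CHAR('a) = 2 \<and> (\<exists>x y. f x y \<noteq> 0) \<or>
    dim UNIV \<ge> 2 \<and> CHAR('a) = 2 \<and> (\<forall>x. x \<noteq> 0 \<longrightarrow> f x x \<noteq> 0)"
proof -
  have vr: "vector_space r"
    using bil by (auto simp: bilinear_map_def Vector_Spaces.linear_def)
  interpret r: vector_space r by fact
  have "0 \<in> (UNIV :: 'b set)" by simp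
  then have UNIV_eq_0: "(UNIV :: 'b set) = {0} \<longleftrightarrow> dim UNIV = 0"
    unfolding dim_eq_0 by blast
  have aniso: "isotropy_index scale f = 0 \<longleftrightarrow> (\<forall>x. x \<noteq> 0 \<longrightarrow> f x x \<noteq> 0)"
    using isotropy_index_eq_0_iff[OF bil] by blast
  consider "dim UNIV = 0" | "dim UNIV = 1" | "dim UNIV \<ge> 2" by linarith
  then show ?thesis
  proof cases
    case 1
    then have "(UNIV :: 'b set) = {0}" using UNIV_eq_0 by blast
    then show ?thesis using aniso by auto
  next
    case 2
    obtain E where E: "independent E" "UNIV \<subseteq> span E" "card E = dim UNIV"
      using basis_exists[of UNIV] by metis
    then obtain e where e: "E = {e}" using 2 by (auto simp: card_1_singleton_iff)
    then have "e \<noteq> 0" using E(1) dependent_zero by blast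
    have vec: "\<exists>c. x = scale c e" for x
      using E(2) e by (auto simp: span_singleton)
    have "(\<exists>x y. f x y \<noteq> 0) \<longleftrightarrow> f e e \<noteq> 0"
      by (metis vec bilinear_map_scale[OF bil] r.scale_zero_right)
    moreover have "(\<forall>x. x \<noteq> 0 \<longrightarrow> f x x \<noteq> 0) \<longleftrightarrow> f e e \<noteq> 0"
      by (metis \<open>e \<noteq> 0\<close> vec bilinear_map_scale[OF bil] r.scale_eq_0_iff scale_eq_0_iff)
    moreover have "f e e \<noteq> 0 \<Longrightarrow> CHAR('a) = 2"
      using skew_symmetric_diagonal_eq_0[OF vr assms(2)] by blast
    ultimately show ?thesis using 2 aniso UNIV_eq_0 by auto
  next
    case 3
    then have "\<exists>x::'b. x \<noteq> 0" using UNIV_eq_0 by auto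
    then have "(\<forall>x. x \<noteq> 0 \<longrightarrow> f x x \<noteq> 0) \<Longrightarrow> CHAR('a) = 2"
      using skew_symmetric_diagonal_eq_0[OF vr assms(2)] by blast
    then show ?thesis using 3 aniso UNIV_eq_0 by auto
  qed
qed

end

section \<open>Equality of pure tensors\<close>

text \<open>
  A linear functional \<open>g\<close> with \<open>g b = 1\<close> and \<open>g b' = 0\<close> induces a linear map on the tensor product
  sending \<open>x \<otimes> y\<close> to \<open>g y \<cdot> x\<close>. It maps the two sides of \<open>a \<otimes> b = a' \<otimes> b'\<close> to \<open>a\<close> and \<open>0\<close>.
\<close>

lemma pure_tensor_eq_imp_left_zero:
  fixes sa :: "'f::field \<Rightarrow> 'a::ab_group_add \<Rightarrow> 'a" and sb :: "'f \<Rightarrow> 'b::ab_group_add \<Rightarrow> 'b"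
  assumes tp: "is_tensor_product sa sb st t" and eq: "t a b = t a' b'"
    and notin: "b \<notin> module.span sb {b'}"
  shows "a = 0"
proof -
  have vs: "vector_space sa" "vector_space sb" using tp by (auto simp: is_tensor_product_def)
  interpret a: vector_space sa by fact
  interpret b: vector_space sb by fact
  interpret field: vector_space "(*) :: 'f \<Rightarrow> 'f \<Rightarrow> 'f"
    by unfold_locales (auto simp: algebra_simps)
  interpret pair: vector_space_pair sb "(*) :: 'f \<Rightarrow> 'f \<Rightarrow> 'f" by unfold_locales
  obtain g where g: "Vector_Spaces.linear sb (*) g" and gb: "g b = 1" and gb': "g b' = 0"
  proof (cases "b' = 0")
    case True
    then have "b.independent {b}" using notin by (auto simp: b.span_zero)
    then obtain g where g: "Vector_Spaces.linear sb (*) g" "g b = (1 :: 'f)"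
      using pair.linear_independent_extend[of "{b}" "\<lambda>_. 1"] by auto
    interpret g: Vector_Spaces.linear sb "(*)" g by (rule g)
    show thesis using that g g.zero True by blast
  next
    case False
    then have "b.independent {b, b'}" and "b \<noteq> b'"
      using notin by (auto simp: b.independent_insert b.span_base)
    then show thesis
      using that pair.linear_independent_extend[of "{b, b'}" "\<lambda>x. if x = b then 1 else 0"]
      by auto
  qed
  interpret g: Vector_Spaces.linear sb "(*)" g by fact
  have "bilinear_map sa sb sa (\<lambda>x y. sa (g y) x)"
    unfolding bilinear_map_def
    by (intro conjI allI; unfold_locales)
      (auto simp: g.add g.scale a.scale_left_distrib a.scale_right_distrib mult.commute)
  then obtain h where "\<And>x y. h (t x y) = sa (g y) x"
    using tensor_product_universal[OF tp] by blast
  then have "sa (g b) a = sa (g b') a'" using eq by metis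
  then show "a = 0" by (simp add: gb gb')
qed

lemma pure_tensor_eq_0:
  assumes tp: "is_tensor_product sa sb st t" and "t a b = 0"
  shows "a = 0 \<or> b = 0"
proof -
  interpret vector_space sb using tp by (simp add: is_tensor_product_def)
  have "t a b = t 0 0"
    using assms(2) bilinear_map_zero[OF is_tensor_product_bilinear[OF tp]] by simp
  then show ?thesis using pure_tensor_eq_imp_left_zero[OF tp] by fastforce
qed

section \<open>Isotropic subspaces of the direct sum\<close>

locale tensor_direct_sum = finite_dimensional_vector_space_prod s\<^sub>1 s\<^sub>2 B\<^sub>1 B\<^sub>2
  for s\<^sub>1 :: "'f::field \<Rightarrow> 'l1::ab_group_add \<Rightarrow> 'l1"
    and s\<^sub>2 :: "'f \<Rightarrow> 'l2::ab_group_add \<Rightarrow> 'l2" and B\<^sub>1 and B\<^sub>2 +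
  fixes r\<^sub>1 :: "'f \<Rightarrow> 'v1::ab_group_add \<Rightarrow> 'v1"
    and r\<^sub>2 :: "'f \<Rightarrow> 'v2::ab_group_add \<Rightarrow> 'v2"
    and r\<^sub>3 :: "'f \<Rightarrow> 'v3::ab_group_add \<Rightarrow> 'v3"
    and t :: "'l1 \<Rightarrow> 'l2 \<Rightarrow> 'v3"
    and \<phi>\<^sub>1 :: "'l1 \<Rightarrow> 'l1 \<Rightarrow> 'v1"
    and \<phi>\<^sub>2 :: "'l2 \<Rightarrow> 'l2 \<Rightarrow> 'v2"
  assumes tp: "is_tensor_product s\<^sub>1 s\<^sub>2 r\<^sub>3 t"
    and bil1: "bilinear_map s\<^sub>1 s\<^sub>1 r\<^sub>1 \<phi>\<^sub>1" and skew1: "skew_symmetric \<phi>\<^sub>1"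
    and bil2: "bilinear_map s\<^sub>2 s\<^sub>2 r\<^sub>2 \<phi>\<^sub>2" and skew2: "skew_symmetric \<phi>\<^sub>2"
begin

abbreviation \<phi> where "\<phi> \<equiv> direct_sum_map \<phi>\<^sub>1 \<phi>\<^sub>2 t"

lemmas bil3 = is_tensor_product_bilinear[OF tp]

lemmas bil = bilinear_direct_sum_map[OF bil1 bil2 bil3]

lemma \<phi>_eq_0_iff:
  "\<phi> (a, b) (c, d) = 0 \<longleftrightarrow> \<phi>\<^sub>1 a c = 0 \<and> \<phi>\<^sub>2 b d = 0 \<and> t a d = t c b"
  by (simp add: direct_sum_map_def zero_prod_def)

lemmas zero_values = bilinear_map_zero[OF bil1] bilinear_map_zero[OF bil2] bilinear_map_zero[OF bil3]

lemma isotropic_left_iff: "isotropic scale \<phi> (H \<times> {0}) \<longleftrightarrow> isotropic s\<^sub>1 \<phi>\<^sub>1 H"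
proof -
  have "p.subspace (H \<times> {0}) \<longleftrightarrow> vs1.subspace H"
    by (auto simp: p.subspace_def vs1.subspace_def zero_prod_def scale_def)
  then show ?thesis by (auto simp: isotropic_def \<phi>_eq_0_iff zero_values)
qed

lemma isotropic_right_iff: "isotropic scale \<phi> ({0} \<times> H) \<longleftrightarrow> isotropic s\<^sub>2 \<phi>\<^sub>2 H"
proof -
  have "p.subspace ({0} \<times> H) \<longleftrightarrow> vs2.subspace H"
    by (auto simp: p.subspace_def vs2.subspace_def zero_prod_def scale_def)
  then show ?thesis by (auto simp: isotropic_def \<phi>_eq_0_iff zero_values)
qed

lemma isotropic_subset_left:
  assumes "isotropic scale \<phi> K" and "K \<subseteq> UNIV \<times> {0}"
  obtains H where "isotropic s\<^sub>1 \<phi>\<^sub>1 H" and "K = H \<times> {0}"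
proof -
  have "K = fst ` K \<times> {0}" using assms(2) by force
  then show thesis using that[of "fst ` K"] assms(1) isotropic_left_iff by metis
qed

lemma isotropic_subset_right:
  assumes "isotropic scale \<phi> K" and "K \<subseteq> {0} \<times> UNIV"
  obtains H where "isotropic s\<^sub>2 \<phi>\<^sub>2 H" and "K = {0} \<times> H"
proof -
  have "K = {0} \<times> snd ` K" using assms(2) by force
  then show thesis using that[of "snd ` K"] assms(1) isotropic_right_iff by metis
qed

lemma dim_left: "p.dim (H \<times> {0}) = vs1.dim H"
proof -
  interpret emb: finite_dimensional_vector_space_pair_1 s\<^sub>1 B\<^sub>1 scale by unfold_locales
  have "Vector_Spaces.linear s\<^sub>1 scale (\<lambda>a. (a, 0))"
    by unfold_locales (auto simp: scale_def)
  then have "p.dim ((\<lambda>a. (a, 0)) ` H) = vs1.dim H"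
    by (rule emb.dim_image_eq) (auto simp: inj_on_def)
  moreover have "(\<lambda>a. (a, 0)) ` H = H \<times> {0 :: 'l2}" by auto
  ultimately show ?thesis by simp
qed

lemma dim_right: "p.dim ({0} \<times> H) = vs2.dim H"
proof -
  interpret emb: finite_dimensional_vector_space_pair_1 s\<^sub>2 B\<^sub>2 scale by unfold_locales
  have "Vector_Spaces.linear s\<^sub>2 scale (\<lambda>b. (0, b))"
    by unfold_locales (auto simp: scale_def)
  then have "p.dim ((\<lambda>b. (0, b)) ` H) = vs2.dim H"
    by (rule emb.dim_image_eq) (auto simp: inj_on_def)
  moreover have "(\<lambda>b. (0, b)) ` H = {0 :: 'l1} \<times> H" by auto
  ultimately show ?thesis by simp
qed

text \<open>
  Maximality in the first summand only tests subspaces of the form \<open>K \<times> {0}\<close>. It implies maximality in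
  the direct sum once every isotropic subspace above \<open>H \<times> {0}\<close> is known to have that form.
\<close>

lemma maximal_isotropic_left_iff:
  assumes "\<And>K. isotropic scale \<phi> K \<Longrightarrow> H \<times> {0} \<subseteq> K \<Longrightarrow> K \<subseteq> UNIV \<times> {0}"
  shows "maximal_isotropic scale \<phi> (H \<times> {0}) \<longleftrightarrow> maximal_isotropic s\<^sub>1 \<phi>\<^sub>1 H"
proof -
  have "(\<exists>K. isotropic scale \<phi> K \<and> H \<times> {0} \<subset> K) \<longleftrightarrow> (\<exists>K. isotropic s\<^sub>1 \<phi>\<^sub>1 K \<and> H \<subset> K)"
  proof
    assume "\<exists>K. isotropic scale \<phi> K \<and> H \<times> {0} \<subset> K"
    then obtain K where K: "isotropic scale \<phi> K" "H \<times> {0} \<subset> K" by blast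
    then obtain H' where "isotropic s\<^sub>1 \<phi>\<^sub>1 H'" "K = H' \<times> {0}"
      using isotropic_subset_left[OF K(1)] assms by blast
    then show "\<exists>K. isotropic s\<^sub>1 \<phi>\<^sub>1 K \<and> H \<subset> K" using K(2) by blast
  next
    assume "\<exists>K. isotropic s\<^sub>1 \<phi>\<^sub>1 K \<and> H \<subset> K"
    then obtain K where K: "isotropic s\<^sub>1 \<phi>\<^sub>1 K" "H \<subset> K" by blast
    then have "isotropic scale \<phi> (K \<times> {0})" "H \<times> {0} \<subset> K \<times> {0}"
      by (auto simp: isotropic_left_iff)
    then show "\<exists>K. isotropic scale \<phi> K \<and> H \<times> {0} \<subset> K" by blast
  qed
  then show ?thesis by (simp add: maximal_isotropic_def isotropic_left_iff)
qed

lemma maximal_isotropic_right_iff: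
  assumes "\<And>K. isotropic scale \<phi> K \<Longrightarrow> {0} \<times> H \<subseteq> K \<Longrightarrow> K \<subseteq> {0} \<times> UNIV"
  shows "maximal_isotropic scale \<phi> ({0} \<times> H) \<longleftrightarrow> maximal_isotropic s\<^sub>2 \<phi>\<^sub>2 H"
proof -
  have "(\<exists>K. isotropic scale \<phi> K \<and> {0} \<times> H \<subset> K) \<longleftrightarrow> (\<exists>K. isotropic s\<^sub>2 \<phi>\<^sub>2 K \<and> H \<subset> K)"
  proof
    assume "\<exists>K. isotropic scale \<phi> K \<and> {0} \<times> H \<subset> K"
    then obtain K where K: "isotropic scale \<phi> K" "{0} \<times> H \<subset> K" by blast
    then obtain H' where "isotropic s\<^sub>2 \<phi>\<^sub>2 H'" "K = {0} \<times> H'"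
      using isotropic_subset_right[OF K(1)] assms by blast
    then show "\<exists>K. isotropic s\<^sub>2 \<phi>\<^sub>2 K \<and> H \<subset> K" using K(2) by blast
  next
    assume "\<exists>K. isotropic s\<^sub>2 \<phi>\<^sub>2 K \<and> H \<subset> K"
    then obtain K where K: "isotropic s\<^sub>2 \<phi>\<^sub>2 K" "H \<subset> K" by blast
    then have "isotropic scale \<phi> ({0} \<times> K)" "{0} \<times> H \<subset> {0} \<times> K"
      by (auto simp: isotropic_right_iff)
    then show "\<exists>K. isotropic scale \<phi> K \<and> {0} \<times> H \<subset> K" by blast
  qed
  then show ?thesis by (simp add: maximal_isotropic_def isotropic_right_iff)
qed

text \<open>
  Isotropy of a subspace containing \<open>(a, 0)\<close> and \<open>(c, d)\<close> forces \<open>a \<otimes> d = 0\<close>. So a nonzero vector of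
  one summand confines the whole isotropic subspace to that summand.
\<close>

lemma isotropic_confined_left:
  assumes "isotropic scale \<phi> K" and "(a, 0) \<in> K" and "a \<noteq> 0"
  shows "K \<subseteq> UNIV \<times> {0}"
proof
  fix x assume "x \<in> K"
  obtain c d where x: "x = (c, d)" by fastforce
  with \<open>x \<in> K\<close> have "(c, d) \<in> K" by simp
  then have "\<phi> (a, 0) (c, d) = 0" using assms by (auto simp: isotropic_def)
  then have "t a d = 0" by (simp add: \<phi>_eq_0_iff zero_values)
  then have "d = 0" using pure_tensor_eq_0[OF tp] assms(3) by blast
  then show "x \<in> UNIV \<times> {0}" by (simp add: x)
qed

lemma isotropic_confined_right:
  assumes "isotropic scale \<phi> K" and "(0, b) \<in> K" and "b \<noteq> 0"
  shows "K \<subseteq> {0} \<times> UNIV"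
proof
  fix x assume "x \<in> K"
  obtain c d where x: "x = (c, d)" by fastforce
  with \<open>x \<in> K\<close> have "(c, d) \<in> K" by simp
  then have "\<phi> (0, b) (c, d) = 0" using assms by (auto simp: isotropic_def)
  then have "t c b = 0" by (simp add: \<phi>_eq_0_iff zero_values)
  then have "c = 0" using pure_tensor_eq_0[OF tp] assms(3) by blast
  then show "x \<in> {0} \<times> UNIV" by (simp add: x)
qed

text \<open>
  If \<open>a\<close> and \<open>b\<close> are nonzero and \<open>(c, d)\<close> is orthogonal to \<open>(a, b)\<close>, then \<open>a \<otimes> d = c \<otimes> b\<close> makes \<open>d\<close>
  a multiple \<open>k b\<close>, and then \<open>(k a - c) \<otimes> b = 0\<close> makes \<open>c\<close> the multiple \<open>k a\<close> with the same factor.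
\<close>

lemma isotropic_mixed_vector_is_line:
  assumes iso: "isotropic scale \<phi> K" and ab: "(a, b) \<in> K" and "a \<noteq> 0" "b \<noteq> 0"
  shows "K = p.span {(a, b)}"
proof
  show "p.span {(a, b)} \<subseteq> K"
    using iso ab by (intro p.span_minimal) (auto simp: isotropic_def)
  show "K \<subseteq> p.span {(a, b)}"
  proof clarify
    fix c d assume "(c, d) \<in> K"
    then have "\<phi> (a, b) (c, d) = 0" using iso ab by (auto simp: isotropic_def)
    then have eq: "t a d = t c b" by (simp add: \<phi>_eq_0_iff)
    then have "d \<in> vs2.span {b}" using pure_tensor_eq_imp_left_zero[OF tp eq] \<open>a \<noteq> 0\<close> by blast
    then obtain k where d: "d = s\<^sub>2 k b" by (auto simp: vs2.span_singleton)
    have "t (s\<^sub>1 k a - c) b = 0"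
      using eq by (simp add: d bilinear_map_diff_left[OF bil3] bilinear_map_scale[OF bil3])
    then have "c = s\<^sub>1 k a" using pure_tensor_eq_0[OF tp] \<open>b \<noteq> 0\<close> by fastforce
    then show "(c, d) \<in> p.span {(a, b)}"
      by (auto simp: d p.span_singleton scale_def)
  qed
qed

lemma isotropic_cases:
  assumes iso: "isotropic scale \<phi> K"
  obtains (mixed) a b where "a \<noteq> 0" "b \<noteq> 0" "K = p.span {(a, b)}"
  | (left) H where "isotropic s\<^sub>1 \<phi>\<^sub>1 H" "K = H \<times> {0}"
  | (right) H where "isotropic s\<^sub>2 \<phi>\<^sub>2 H" "K = {0} \<times> H"
proof -
  consider "K \<subseteq> UNIV \<times> {0}" | "K \<subseteq> {0} \<times> UNIV" | a b where "(a, b) \<in> K" "a \<noteq> 0" "b \<noteq> 0"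
    using isotropic_confined_left[OF iso] isotropic_confined_right[OF iso] by fast
  then show thesis
  proof cases
    case 1
    then show thesis using isotropic_subset_left[OF iso] left by blast
  next
    case 2
    then show thesis using isotropic_subset_right[OF iso] right by blast
  next
    case 3
    then show thesis using isotropic_mixed_vector_is_line[OF iso] mixed by blast
  qed
qed

lemma \<phi>_diagonal_eq_0_iff: "\<phi> (a, b) (a, b) = 0 \<longleftrightarrow> \<phi>\<^sub>1 a a = 0 \<and> \<phi>\<^sub>2 b b = 0"
  by (simp add: \<phi>_eq_0_iff)

lemma isotropic_diagonal:
  assumes "isotropic scale \<phi> K" and "(a, b) \<in> K"
  shows "\<phi>\<^sub>1 a a = 0 \<and> \<phi>\<^sub>2 b b = 0"
  using assms unfolding isotropic_def \<phi>_diagonal_eq_0_iff[symmetric] by blast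

lemma diagonal_eq_0_if_char_ne_2:
  assumes "CHAR('f) \<noteq> 2"
  shows "\<phi>\<^sub>1 a a = 0" and "\<phi>\<^sub>2 b b = 0"
proof -
  have "vector_space r\<^sub>1" "vector_space r\<^sub>2"
    using bil1 bil2 by (auto simp: bilinear_map_def Vector_Spaces.linear_def)
  then show "\<phi>\<^sub>1 a a = 0" and "\<phi>\<^sub>2 b b = 0"
    by (simp_all add: skew_symmetric_diagonal_eq_0[OF _ skew1 assms]
        skew_symmetric_diagonal_eq_0[OF _ skew2 assms])
qed

text \<open>
  The condition on the diagonal is what makes a line isotropic. Outside characteristic \<open>2\<close> it follows
  from skew-symmetry, so there every line qualifies.
\<close>

lemma isotropic_iff:
  assumes "p.subspace H"
  shows "isotropic scale \<phi> H \<longleftrightarrow>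
    (p.dim H = 1 \<and> (CHAR('f) = 2 \<longrightarrow> (\<forall>(x\<^sub>1, x\<^sub>2)\<in>H. \<phi>\<^sub>1 x\<^sub>1 x\<^sub>1 = 0 \<and> \<phi>\<^sub>2 x\<^sub>2 x\<^sub>2 = 0))) \<or>
    (\<exists>H\<^sub>1. isotropic s\<^sub>1 \<phi>\<^sub>1 H\<^sub>1 \<and> H = H\<^sub>1 \<times> {0}) \<or>
    (\<exists>H\<^sub>2. isotropic s\<^sub>2 \<phi>\<^sub>2 H\<^sub>2 \<and> H = {0} \<times> H\<^sub>2)" (is "_ \<longleftrightarrow> ?line \<or> ?left \<or> ?right")
proof
  assume iso: "isotropic scale \<phi> H"
  then show "?line \<or> ?left \<or> ?right"
  proof (cases rule: isotropic_cases)
    case (mixed a b)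
    then have "p.dim H = 1" by (simp add: zero_prod_def)
    then show ?thesis using isotropic_diagonal[OF iso] by (intro disjI1) auto
  next
    case (left H\<^sub>1)
    then have ?left by (intro exI conjI)
    then show ?thesis by (intro disjI2 disjI1)
  next
    case (right H\<^sub>2)
    then have ?right by (intro exI conjI)
    then show ?thesis by (intro disjI2)
  qed
next
  assume "?line \<or> ?left \<or> ?right"
  then show "isotropic scale \<phi> H"
  proof (elim disjE)
    assume line: ?line
    obtain E where E: "E \<subseteq> H" "H \<subseteq> p.span E" "card E = p.dim H"
      using p.basis_exists[of H] by metis
    then obtain x where x: "E = {x}" using line by (auto simp: card_1_singleton_iff)
    have "H = p.span {x}"
      using E x assms p.span_minimal[of E H] by blast
    obtain a b where ab: "x = (a, b)" by fastforce
    have "\<phi>\<^sub>1 a a = 0 \<and> \<phi>\<^sub>2 b b = 0"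
    proof (cases "CHAR('f) = 2")
      case True
      then show ?thesis using line E(1) x ab by auto
    next
      case False
      then show ?thesis using diagonal_eq_0_if_char_ne_2 by blast
    qed
    then have "\<phi> x x = 0" by (simp add: ab \<phi>_diagonal_eq_0_iff)
    then show ?thesis
      unfolding \<open>H = p.span {x}\<close> p.isotropic_span_singleton_iff[OF bil] .
  next
    assume ?left then show ?thesis by (auto simp: isotropic_left_iff)
  next
    assume ?right then show ?thesis by (auto simp: isotropic_right_iff)
  qed
qed

section \<open>Dimensions of maximal isotropic subspaces\<close>

text \<open>
  A nonzero isotropic subspace of a summand cannot be enlarged outside that summand, so maximality there
  and in the direct sum agree. The assumption on the indices makes all maximal isotropic subspaces
  nonzero, and it provides the mixed isotropic vector \<open>(u, v)\<close> whose line accounts for the dimension \<open>1\<close>.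
\<close>

lemma isotropic_dims_both_isotropic:
  assumes index1: "isotropy_index s\<^sub>1 \<phi>\<^sub>1 \<noteq> 0" and index2: "isotropy_index s\<^sub>2 \<phi>\<^sub>2 \<noteq> 0"
  shows "isotropic_dims scale \<phi> = {1} \<union> isotropic_dims s\<^sub>1 \<phi>\<^sub>1 \<union> isotropic_dims s\<^sub>2 \<phi>\<^sub>2"
proof -
  have left_iff: "maximal_isotropic scale \<phi> (H \<times> {0}) \<longleftrightarrow> maximal_isotropic s\<^sub>1 \<phi>\<^sub>1 H"
    if "a \<in> H" "a \<noteq> 0" for H a
    using that by (intro maximal_isotropic_left_iff isotropic_confined_left) auto
  have right_iff: "maximal_isotropic scale \<phi> ({0} \<times> H) \<longleftrightarrow> maximal_isotropic s\<^sub>2 \<phi>\<^sub>2 H"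
    if "b \<in> H" "b \<noteq> 0" for H b
    using that by (intro maximal_isotropic_right_iff isotropic_confined_right) auto
  obtain u where u: "\<phi>\<^sub>1 u u = 0" "u \<noteq> 0"
    using index1 unfolding vs1.isotropy_index_eq_0_iff[OF bil1] by blast
  obtain v where v: "\<phi>\<^sub>2 v v = 0" "v \<noteq> 0"
    using index2 unfolding vs2.isotropy_index_eq_0_iff[OF bil2] by blast
  have uv: "isotropic scale \<phi> (p.span {(u, v)})"
    using u v by (simp add: p.isotropic_span_singleton_iff[OF bil] \<phi>_diagonal_eq_0_iff)
  have uv_max: "maximal_isotropic scale \<phi> (p.span {(u, v)})"
  proof -
    have "K = p.span {(u, v)}" if "isotropic scale \<phi> K" "p.span {(u, v)} \<subset> K" for K
      using that u v isotropic_mixed_vector_is_line p.span_base by blast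
    then show ?thesis using uv by (auto simp: maximal_isotropic_def)
  qed
  have index: "isotropy_index scale \<phi> \<noteq> 0"
    using u v unfolding p.isotropy_index_eq_0_iff[OF bil]
    by (metis \<phi>_diagonal_eq_0_iff prod.inject zero_prod_def)
  have uv_dim: "p.dim (p.span {(u, v)}) = 1" using u by (simp add: zero_prod_def)
  show ?thesis
  proof (intro subset_antisym subsetI)
    fix n assume "n \<in> isotropic_dims scale \<phi>"
    then obtain K where K: "maximal_isotropic scale \<phi> K" and n: "n = p.dim K"
      by (auto simp: isotropic_dims_def)
    have "isotropic scale \<phi> K" using K by (simp add: maximal_isotropic_def)
    then show "n \<in> {1} \<union> isotropic_dims s\<^sub>1 \<phi>\<^sub>1 \<union> isotropic_dims s\<^sub>2 \<phi>\<^sub>2"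
    proof (cases rule: isotropic_cases)
      case (mixed a b)
      then show ?thesis by (simp add: n zero_prod_def)
    next
      case (left H)
      obtain a where "a \<in> H" "a \<noteq> 0"
        using p.maximal_isotropic_nonzero[OF bil index K] unfolding left(2) zero_prod_def by blast
      then have "maximal_isotropic s\<^sub>1 \<phi>\<^sub>1 H" using left_iff K left(2) by blast
      then show ?thesis by (auto simp: n left(2) dim_left isotropic_dims_def)
    next
      case (right H)
      obtain b where "b \<in> H" "b \<noteq> 0"
        using p.maximal_isotropic_nonzero[OF bil index K] unfolding right(2) zero_prod_def by blast
      then have "maximal_isotropic s\<^sub>2 \<phi>\<^sub>2 H" using right_iff K right(2) by blast
      then show ?thesis by (auto simp: n right(2) dim_right isotropic_dims_def)
    qed
  next
    fix n assume "n \<in> {1} \<union> isotropic_dims s\<^sub>1 \<phi>\<^sub>1 \<union> isotropic_dims s\<^sub>2 \<phi>\<^sub>2"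
    then consider "n = 1"
      | H where "maximal_isotropic s\<^sub>1 \<phi>\<^sub>1 H" "n = vs1.dim H"
      | H where "maximal_isotropic s\<^sub>2 \<phi>\<^sub>2 H" "n = vs2.dim H"
      by (auto simp: isotropic_dims_def)
    then show "n \<in> isotropic_dims scale \<phi>"
    proof cases
      case 1
      then show ?thesis using isotropic_dimsI[OF uv_max] uv_dim by metis
    next
      case 2
      obtain a where "a \<in> H" "a \<noteq> 0" by (rule vs1.maximal_isotropic_nonzero[OF bil1 index1 2(1)])
      then have "maximal_isotropic scale \<phi> (H \<times> {0})" using left_iff 2(1) by blast
      from isotropic_dimsI[OF this] show ?thesis by (simp add: 2(2) dim_left)
    next
      case 3
      obtain b where "b \<in> H" "b \<noteq> 0" by (rule vs2.maximal_isotropic_nonzero[OF bil2 index2 3(1)])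
      then have "maximal_isotropic scale \<phi> ({0} \<times> H)" using right_iff 3(1) by blast
      from isotropic_dimsI[OF this] show ?thesis by (simp add: 3(2) dim_right)
    qed
  qed
qed

text \<open>
  An isotropic vector \<open>(a, b)\<close> of the direct sum satisfies \<open>\<phi>\<^sub>2 b b = 0\<close>, so a summand without nonzero
  isotropic vectors contributes nothing to any isotropic subspace. In particular no line spanned by
  a mixed vector is isotropic, which is why \<open>1\<close> need not be a dimension here.
\<close>

lemma isotropic_dims_right_anisotropic:
  assumes "isotropy_index s\<^sub>2 \<phi>\<^sub>2 = 0"
  shows "isotropic_dims scale \<phi> = isotropic_dims s\<^sub>1 \<phi>\<^sub>1"
proof -
  have aniso: "b = 0" if "\<phi>\<^sub>2 b b = 0" for b
    using assms that by (simp add: vs2.isotropy_index_eq_0_iff[OF bil2])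
  have sub: "K \<subseteq> UNIV \<times> {0}" if "isotropic scale \<phi> K" for K
    using isotropic_diagonal[OF that] aniso by fast
  have left_iff: "maximal_isotropic scale \<phi> (H \<times> {0}) \<longleftrightarrow> maximal_isotropic s\<^sub>1 \<phi>\<^sub>1 H" for H
    using sub by (intro maximal_isotropic_left_iff)
  have "{K. maximal_isotropic scale \<phi> K} = (\<lambda>H. H \<times> {0}) ` {H. maximal_isotropic s\<^sub>1 \<phi>\<^sub>1 H}"
  proof (intro subset_antisym subsetI)
    fix K assume "K \<in> {K. maximal_isotropic scale \<phi> K}"
    then have K: "maximal_isotropic scale \<phi> K" by simp
    then have "isotropic scale \<phi> K" by (simp add: maximal_isotropic_def)
    then obtain H where "K = H \<times> {0}" using isotropic_subset_left sub by metis
    then show "K \<in> (\<lambda>H. H \<times> {0}) ` {H. maximal_isotropic s\<^sub>1 \<phi>\<^sub>1 H}" using K left_iff by blast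
  qed (auto simp: left_iff)
  then show ?thesis by (simp add: isotropic_dims_def image_image dim_left)
qed

lemma isotropic_dims_left_anisotropic:
  assumes "isotropy_index s\<^sub>1 \<phi>\<^sub>1 = 0"
  shows "isotropic_dims scale \<phi> = isotropic_dims s\<^sub>2 \<phi>\<^sub>2"
proof -
  have aniso: "a = 0" if "\<phi>\<^sub>1 a a = 0" for a
    using assms that by (simp add: vs1.isotropy_index_eq_0_iff[OF bil1])
  have sub: "K \<subseteq> {0} \<times> UNIV" if "isotropic scale \<phi> K" for K
    using isotropic_diagonal[OF that] aniso by fast
  have right_iff: "maximal_isotropic scale \<phi> ({0} \<times> H) \<longleftrightarrow> maximal_isotropic s\<^sub>2 \<phi>\<^sub>2 H" for H
    using sub by (intro maximal_isotropic_right_iff)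
  have "{K. maximal_isotropic scale \<phi> K} = (\<lambda>H. {0} \<times> H) ` {H. maximal_isotropic s\<^sub>2 \<phi>\<^sub>2 H}"
  proof (intro subset_antisym subsetI)
    fix K assume "K \<in> {K. maximal_isotropic scale \<phi> K}"
    then have K: "maximal_isotropic scale \<phi> K" by simp
    then have "isotropic scale \<phi> K" by (simp add: maximal_isotropic_def)
    then obtain H where "K = {0} \<times> H" using isotropic_subset_right sub by metis
    then show "K \<in> (\<lambda>H. {0} \<times> H) ` {H. maximal_isotropic s\<^sub>2 \<phi>\<^sub>2 H}" using K right_iff by blast
  qed (auto simp: right_iff)
  then show ?thesis by (simp add: isotropic_dims_def image_image dim_right)
qed

lemma isotropy_index_eq_max:
  "isotropy_index scale \<phi> = max (isotropy_index s\<^sub>1 \<phi>\<^sub>1) (isotropy_index s\<^sub>2 \<phi>\<^sub>2)"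
proof -
  consider "isotropy_index s\<^sub>1 \<phi>\<^sub>1 = 0" | "isotropy_index s\<^sub>2 \<phi>\<^sub>2 = 0"
    | "isotropy_index s\<^sub>1 \<phi>\<^sub>1 \<noteq> 0" "isotropy_index s\<^sub>2 \<phi>\<^sub>2 \<noteq> 0" by blast
  then show ?thesis
  proof cases
    case 1
    then show ?thesis using isotropic_dims_left_anisotropic by (simp add: isotropy_index_def)
  next
    case 2
    then show ?thesis using isotropic_dims_right_anisotropic by (simp add: isotropy_index_def)
  next
    case 3
    \<comment> \<open>The extra dimension \<open>1\<close> is absorbed because both indices are positive.\<close>
    note dims = vs1.finite_isotropic_dims[of \<phi>\<^sub>1] vs1.isotropic_dims_nonempty[OF bil1]
      vs2.finite_isotropic_dims[of \<phi>\<^sub>2] vs2.isotropic_dims_nonempty[OF bil2]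
    have "isotropy_index scale \<phi> =
        max 1 (max (isotropy_index s\<^sub>1 \<phi>\<^sub>1) (isotropy_index s\<^sub>2 \<phi>\<^sub>2))"
      unfolding isotropy_index_def isotropic_dims_both_isotropic[OF 3]
      by (simp add: Max_Un dims)
    then show ?thesis using 3 by simp
  qed
qed

end

theorem lemma26:
  fixes s\<^sub>1 :: "'f::field \<Rightarrow> 'l1::ab_group_add \<Rightarrow> 'l1"
    and s\<^sub>2 :: "'f \<Rightarrow> 'l2::ab_group_add \<Rightarrow> 'l2"
    and r\<^sub>1 :: "'f \<Rightarrow> 'v1::ab_group_add \<Rightarrow> 'v1"
    and r\<^sub>2 :: "'f \<Rightarrow> 'v2::ab_group_add \<Rightarrow> 'v2"
    and r\<^sub>3 :: "'f \<Rightarrow> 'v3::ab_group_add \<Rightarrow> 'v3"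
    and tensor :: "'l1 \<Rightarrow> 'l2 \<Rightarrow> 'v3"
    and \<phi>\<^sub>1 :: "'l1 \<Rightarrow> 'l1 \<Rightarrow> 'v1"
    and \<phi>\<^sub>2 :: "'l2 \<Rightarrow> 'l2 \<Rightarrow> 'v2"
  assumes "finite_dimensional_vector_space s\<^sub>1 B\<^sub>1"
    and "finite_dimensional_vector_space s\<^sub>2 B\<^sub>2"
    and "finite_dimensional_vector_space r\<^sub>1 C\<^sub>1"
    and "finite_dimensional_vector_space r\<^sub>2 C\<^sub>2"
    and "is_tensor_product s\<^sub>1 s\<^sub>2 r\<^sub>3 tensor"
    and "bilinear_map s\<^sub>1 s\<^sub>1 r\<^sub>1 \<phi>\<^sub>1" and "skew_symmetric \<phi>\<^sub>1"
    and "bilinear_map s\<^sub>2 s\<^sub>2 r\<^sub>2 \<phi>\<^sub>2" and "skew_symmetric \<phi>\<^sub>2"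
  defines "s \<equiv> module_prod.scale s\<^sub>1 s\<^sub>2"
    and "\<phi> \<equiv> direct_sum_map \<phi>\<^sub>1 \<phi>\<^sub>2 tensor"
  shows
    "(\<forall>H. module.subspace s H \<longrightarrow>
        (isotropic s \<phi> H \<longleftrightarrow>
          (vector_space.dim s H = 1 \<and>
            (CHAR('f) = 2 \<longrightarrow> (\<forall>(x\<^sub>1, x\<^sub>2)\<in>H. \<phi>\<^sub>1 x\<^sub>1 x\<^sub>1 = 0 \<and> \<phi>\<^sub>2 x\<^sub>2 x\<^sub>2 = 0))) \<or>
          (\<exists>H\<^sub>1. isotropic s\<^sub>1 \<phi>\<^sub>1 H\<^sub>1 \<and> H = H\<^sub>1 \<times> {0}) \<or>
          (\<exists>H\<^sub>2. isotropic s\<^sub>2 \<phi>\<^sub>2 H\<^sub>2 \<and> H = {0} \<times> H\<^sub>2)))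
     \<and>
     (isotropy_index s\<^sub>1 \<phi>\<^sub>1 \<noteq> 0 \<and> isotropy_index s\<^sub>2 \<phi>\<^sub>2 \<noteq> 0 \<longrightarrow>
        isotropic_dims s \<phi> = {1} \<union> isotropic_dims s\<^sub>1 \<phi>\<^sub>1 \<union> isotropic_dims s\<^sub>2 \<phi>\<^sub>2)
     \<and> (isotropy_index s\<^sub>2 \<phi>\<^sub>2 = 0 \<longrightarrow> isotropic_dims s \<phi> = isotropic_dims s\<^sub>1 \<phi>\<^sub>1)
     \<and> (isotropy_index s\<^sub>1 \<phi>\<^sub>1 = 0 \<longrightarrow> isotropic_dims s \<phi> = isotropic_dims s\<^sub>2 \<phi>\<^sub>2)
     \<and> (isotropy_index s\<^sub>1 \<phi>\<^sub>1 = 0 \<longleftrightarrow>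
          (UNIV :: 'l1 set) = {0} \<or>
          vector_space.dim s\<^sub>1 UNIV = 1 \<and> CHAR('f) = 2 \<and> (\<exists>x y. \<phi>\<^sub>1 x y \<noteq> 0) \<or>
          vector_space.dim s\<^sub>1 UNIV \<ge> 2 \<and> CHAR('f) = 2 \<and> (\<forall>x. x \<noteq> 0 \<longrightarrow> \<phi>\<^sub>1 x x \<noteq> 0))
     \<and> (isotropy_index s\<^sub>2 \<phi>\<^sub>2 = 0 \<longleftrightarrow>
          (UNIV :: 'l2 set) = {0} \<or>
          vector_space.dim s\<^sub>2 UNIV = 1 \<and> CHAR('f) = 2 \<and> (\<exists>x y. \<phi>\<^sub>2 x y \<noteq> 0) \<or>
          vector_space.dim s\<^sub>2 UNIV \<ge> 2 \<and> CHAR('f) = 2 \<and> (\<forall>x. x \<noteq> 0 \<longrightarrow> \<phi>\<^sub>2 x x \<noteq> 0))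
     \<and>
     isotropy_index s \<phi> = max (isotropy_index s\<^sub>1 \<phi>\<^sub>1) (isotropy_index s\<^sub>2 \<phi>\<^sub>2)"
proof -
  interpret tensor_direct_sum s\<^sub>1 s\<^sub>2 B\<^sub>1 B\<^sub>2 r\<^sub>1 r\<^sub>2 r\<^sub>3 tensor \<phi>\<^sub>1 \<phi>\<^sub>2
    using assms(1,2,5-9)
    unfolding tensor_direct_sum_def tensor_direct_sum_axioms_def
      finite_dimensional_vector_space_prod_def finite_dimensional_vector_space_pair_def
      vector_space_prod_def vector_space_pair_def finite_dimensional_vector_space_def
    by blast
  show ?thesis
    unfolding s_def \<phi>_def
    using isotropic_iff isotropic_dims_both_isotropic isotropic_dims_right_anisotropic
      isotropic_dims_left_anisotropic isotropy_index_eq_max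
      vs1.isotropy_index_eq_0_cases[OF bil1 skew1] vs2.isotropy_index_eq_0_cases[OF bil2 skew2]
    by (intro conjI allI impI) (assumption | simp only: simp_thms)+
qed

end
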